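(* Suppose $0\le v<w\le1$, and let $\theta=\sin^{-1}(w)-\sin^{-1}(v)$. Then $$\begin{aligned}2\,\mathrm{S}(v,w)=\;&\mathrm{S}(v,v)+\mathrm{S}(w,w)-\mathrm{S}(\sin\theta,\sin\theta)-2\mathrm{Li}_3\left(\frac vw\right)+\mathrm{Li}_3\left(\frac vw e^{i\theta}\right)+\mathrm{Li}_3\left(\frac vw e^{-i\theta}\right)\\&-i\theta\,\mathrm{Li}_2\left(\frac vw e^{i\theta}\right)+i\theta\,\mathrm{Li}_2\left(\frac vw e^{-i\theta}\right)+\frac{\theta^2}{2}\log\left(1+\frac{v^2}{w^2}-\frac{2v}{w}\cos\theta\right).\end{aligned}$$ Here each of $\mathrm{S}(v,v)$, $\mathrm{S}(w,w)$, $\mathrm{S}(\sin\theta,\sin\theta)$ reduces to standard polylogarithms through the formula, valid for $0\le s\le1$, $$\begin{aligned}\mathrm{S}(s,s)=\;&\frac{\mathrm{Li}_3\left(e^{2i\sin^{-1}(s)}\right)+\mathrm{Li}_3\left(e^{-2i\sin^{-1}(s)}\right)}{4}-\frac{\zeta(3)}{2}\\&+\sin^{-1}(s)\,\frac{\mathrm{Li}_2\left(e^{2i\sin^{-1}(s)}\right)-\mathrm{Li}_2\left(e^{-2i\sin^{-1}(s)}\right)}{2i}+\left(\sin^{-1}(s)\right)^2\log(2s).\end{aligned}$$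
   Context: The function $\mathrm{S}$ is $\mathrm{S}(v,w)=\int_0^1\frac{\sin^{-1}(vx)\sin^{-1}(wx)}{x}\,dx$. The polylogarithm is $\mathrm{Li}_k(z)=\sum_{n\ge1}z^n/n^k$ (for $k=2,3$ the series converges for $|z|\le1$). At $s=0$ the term $(\sin^{-1}(s))^2\log(2s)$ is read as its limit $0$. *)

theory Defs
  imports "HOL-Analysis.Analysis"
begin

text \<open>The integrand below is \<open>0\<close> at \<open>x = 0\<close>, because \<open>0 / 0 = 0\<close>. For \<open>\<bar>v\<bar>, \<bar>w\<bar> \<le> 1\<close> this is its
  continuous extension, so it is continuous on \<open>[0, 1]\<close> and the integral is an ordinary one.\<close>

definition S :: "real \<Rightarrow> real \<Rightarrow> real" where
  "S v w = integral {0..1} (\<lambda>x. arcsin (v * x) * arcsin (w * x) / x)"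

text \<open>For \<open>k \<ge> 2\<close> the series converges exactly on the closed unit disc; \<open>polylog\<close> is meaningful
  only there, with no analytic continuation beyond it.\<close>

definition polylog :: "nat \<Rightarrow> complex \<Rightarrow> complex" where
  "polylog k z = (\<Sum>n. z ^ Suc n / of_nat (Suc n) ^ k)"

text \<open>The Riemann zeta function at integers \<open>k \<ge> 2\<close>.\<close>

definition zeta_nat :: "nat \<Rightarrow> real" where
  "zeta_nat k = (\<Sum>n. 1 / real (Suc n) ^ k)"

end

theory Submission
  imports Defs
begin

text \<open>With \<open>r = v / w\<close> fixed and \<open>\<theta>(x) = arcsin (w x) - arcsin (v x)\<close>, one has
  \<open>S v v + S w w - 2 S v w = \<integral> \<theta>(x)\<^sup>2 / x dx\<close> over \<open>[0, 1]\<close>. The polylogarithmic terms form a function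
  \<open>2 F(r, \<theta>)\<close> (\<open>F\<close> is \<open>arc_primitive\<close>) whose \<open>\<theta>\<close>-derivative is \<open>\<theta>\<^sup>2 r sin \<theta> / (1 + r\<^sup>2 - 2 r cos \<theta>)\<close>. In the limit \<open>r \<rightarrow> 1\<close> this
  becomes \<open>\<theta>\<^sup>2 cot (\<theta> / 2) / 2\<close>, which gives \<open>S s s = F(1, 2 arcsin s) / 2\<close>; for \<open>r = v / w\<close> the sine rule
  in the triangle with sides \<open>v x\<close>, \<open>w x\<close> and angle \<open>\<theta>\<close> between them identifies \<open>\<theta>\<^sup>2 / x\<close> with the derivative
  of \<open>F(1, 2 \<theta>) / 2 - 2 F(r, \<theta>)\<close> along \<open>x\<close>.\<close>

section \<open>Polylogarithms inside the unit disc\<close>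

text \<open>Since \<open>k > 0\<close>, the added term at \<open>n = 0\<close> is
  \<open>1 / 0 = 0\<close>. Indexing from 0 is the form that \<open>Ln_series\<close> and
  term-by-term differentiation work with.\<close>

lemma polylog_eq_power_series:
  assumes "norm z < 1" "k > 0"
  shows "polylog k z = (\<Sum>n. 1 / of_nat n ^ k * z ^ n)"
proof -
  have "summable (\<lambda>n. 1 / of_nat n ^ k * z ^ n)"
  proof (rule summable_comparison_test')
    show "summable (\<lambda>n. norm z ^ n)" using assms by (simp add: summable_geometric)
    fix n :: nat
    show "norm (1 / of_nat n ^ k * z ^ n) \<le> norm z ^ n"
    proof (cases "n = 0")
      case True
      then show ?thesis using assms by (simp add: zero_power)
    next
      case False
      then have "1 / real n ^ k \<le> 1" by (simp add: divide_le_eq)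
      from mult_right_mono[OF this, of "norm z ^ n"] show ?thesis
        by (simp add: norm_mult norm_divide norm_power)
    qed
  qed
  then have "(\<Sum>n. 1 / of_nat (Suc n) ^ k * z ^ Suc n)
      = (\<Sum>n. 1 / of_nat n ^ k * z ^ n) - 1 / of_nat 0 ^ k * z ^ 0"
    by (rule suminf_split_head)
  then show ?thesis using assms by (simp add: polylog_def)
qed

lemma polylog_1:
  assumes "norm z < 1"
  shows "polylog 1 z = - Ln (1 - z)"
proof -
  have "(\<lambda>n. (-1) ^ Suc n / of_nat n * (- z) ^ n) sums Ln (1 + - z)"
    using Ln_series[of "- z"] assms by simp
  then have "(\<lambda>n. - (1 / of_nat n * z ^ n)) sums Ln (1 - z)"
    by (simp add: uminus_power_if if_distrib cong: if_cong)
  from sums_minus[OF this] have "(\<lambda>n. 1 / of_nat n * z ^ n) sums - Ln (1 - z)"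
    by simp
  then show ?thesis
    using polylog_eq_power_series[OF assms, of 1] by (simp add: sums_iff)
qed

text \<open>Differentiating \<open>z ^ n / n ^ Suc k\<close> cancels one factor \<open>n\<close>.
  The product \<open>z * D\<close> avoids a division by \<open>z\<close>, so \<open>z = 0\<close> is
  covered.\<close>

lemma polylog_has_field_derivative:
  assumes "norm z < 1"
  obtains D where "(polylog (Suc k) has_field_derivative D) (at z)" "z * D = polylog k z"
proof
  let ?c = "\<lambda>n. 1 / of_nat n ^ Suc k :: complex"
  have summ: "summable (\<lambda>n. 1 / of_nat (Suc n) ^ j * w ^ n)" if "norm w < 1" for w :: complex and j
  proof (rule summable_comparison_test')
    show "summable (\<lambda>n. norm w ^ n)" using that by (simp add: summable_geometric)
    fix n :: nat
    have "1 / real (Suc n) ^ j \<le> 1" by simp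
    from mult_right_mono[OF this, of "norm w ^ n"]
    show "norm (1 / of_nat (Suc n) ^ j * w ^ n) \<le> norm w ^ n"
      by (simp add: norm_mult norm_divide norm_power del: of_nat_Suc)
  qed
  have summc: "summable (\<lambda>n. ?c n * w ^ n)" if "norm w < 1" for w
    by (subst summable_Suc_iff[symmetric])
       (use summable_mult[OF summ[OF that, of "Suc k"], of w] in \<open>simp add: mult_ac\<close>)
  have *: "((\<lambda>z. \<Sum>n. ?c n * z ^ n) has_field_derivative (\<Sum>n. diffs ?c n * z ^ n)) (at z)"
    by (rule termdiffs_strong'[where K = 1]) (use summc assms in auto)
  show "(polylog (Suc k) has_field_derivative (\<Sum>n. diffs ?c n * z ^ n)) (at z)"
  proof (rule has_field_derivative_transform_within_open[OF *, of "ball 0 1"])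
    show "(\<Sum>n. ?c n * w ^ n) = polylog (Suc k) w" if "w \<in> ball 0 1" for w
      using polylog_eq_power_series[of w "Suc k"] that by simp
  qed (use assms in auto)
  have "diffs ?c = (\<lambda>n. 1 / of_nat (Suc n) ^ k)"
    by (auto simp: diffs_def fun_eq_iff simp del: of_nat_Suc)
  then show "z * (\<Sum>n. diffs ?c n * z ^ n) = polylog k z"
    using suminf_mult[OF summ[OF assms, of k], of z]
    by (simp add: polylog_def mult_ac)
qed

text \<open>On a circle about 0 one has \<open>dz/dt = \<i> * z\<close>, so the chain rule yields
  exactly the product \<open>z * D\<close> of the previous lemma.\<close>

lemma polylog_rcis_has_vector_derivative:
  assumes "0 \<le> r" "r < 1"
  shows "((\<lambda>t. polylog (Suc k) (rcis r t)) has_vector_derivative \<i> * polylog k (rcis r t)) (at t)"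
proof -
  obtain D where D: "(polylog (Suc k) has_field_derivative D) (at (rcis r t))"
      "rcis r t * D = polylog k (rcis r t)"
    using polylog_has_field_derivative[of "rcis r t" k] assms by auto
  have "((\<lambda>t. rcis r t) has_vector_derivative \<i> * rcis r t) (at t)"
    unfolding rcis_def cis_conv_exp
    by (rule has_vector_derivative_real_field derivative_eq_intros refl | simp)+
  from field_vector_diff_chain_at[OF this D(1)] show ?thesis
    using D(2) by (simp add: o_def mult_ac)
qed

section \<open>Polylogarithms on the closed unit disc\<close>

lemma summable_inverse_Suc_power:
  assumes "k \<ge> 2"
  shows "summable (\<lambda>n. 1 / real (Suc n) ^ k)"
  using inverse_power_summable[OF assms, where 'a = real]
    summable_Suc_iff[of "\<lambda>n. 1 / real n ^ k"]
  by (simp add: inverse_eq_divide)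

lemma norm_polylog_term_le:
  fixes z :: complex
  assumes "norm z \<le> 1"
  shows "norm (z ^ Suc n / of_nat (Suc n) ^ k) \<le> 1 / real (Suc n) ^ k"
  using power_le_one[of "norm z" "Suc n"] assms
  by (simp add: norm_divide norm_mult norm_power divide_right_mono del: of_nat_Suc power_Suc)

text \<open>The series converges uniformly by the M-test. Continuity up to the boundary is what
  later permits the limit from \<open>r < 1\<close> to \<open>r = 1\<close>.\<close>

lemma continuous_on_polylog:
  assumes "k \<ge> 2"
  shows "continuous_on (cball 0 1) (polylog k)"
proof -
  have "uniform_limit (cball 0 1) (\<lambda>N z. \<Sum>n<N. z ^ Suc n / of_nat (Suc n) ^ k :: complex)
      (\<lambda>z. \<Sum>n. z ^ Suc n / of_nat (Suc n) ^ k) sequentially"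
  proof (rule Weierstrass_m_test)
    show "summable (\<lambda>n. 1 / real (Suc n) ^ k)"
      by (rule summable_inverse_Suc_power[OF assms])
    show "norm (z ^ Suc n / of_nat (Suc n) ^ k) \<le> 1 / real (Suc n) ^ k"
      if "z \<in> cball 0 1" for n and z :: complex
      using that by (intro norm_polylog_term_le) simp
  qed
  then show ?thesis
    unfolding polylog_def[abs_def]
    by (rule uniform_limit_theorem[rotated])
       (auto intro!: always_eventually continuous_intros simp del: of_nat_Suc)
qed

lemma polylog_one:
  assumes "k \<ge> 2"
  shows "polylog k 1 = of_real (zeta_nat k)"
  using summable_inverse_Suc_power[OF assms]
  by (simp add: polylog_def zeta_nat_def suminf_of_real)

lemma polylog_cnj:
  assumes "k \<ge> 2" "norm z \<le> 1"
  shows "polylog k (cnj z) = cnj (polylog k z)"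
proof -
  have "summable (\<lambda>n. z ^ Suc n / of_nat (Suc n) ^ k)"
  using summable_inverse_Suc_power[OF assms(1)] norm_polylog_term_le[OF assms(2)]
    by (rule summable_comparison_test')
  then have "(\<lambda>n. z ^ Suc n / of_nat (Suc n) ^ k) sums polylog k z"
    unfolding polylog_def by (rule summable_sums)
  then have "(\<lambda>n. cnj (z ^ Suc n / of_nat (Suc n) ^ k)) sums cnj (polylog k z)"
    by (simp only: sums_cnj)
  then show ?thesis
    by (simp add: polylog_def sums_iff)
qed

section \<open>The primitive and its derivative in the angle\<close>

lemma norm_one_minus_rcis_sq: "(norm (1 - rcis r t))\<^sup>2 = 1 + r\<^sup>2 - 2 * r * cos t"
proof -
  have "(norm (1 - rcis r t))\<^sup>2 = (1 - r * cos t)\<^sup>2 + (r * sin t)\<^sup>2"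
    by (simp add: cmod_power2)
  also have "\<dots> = 1 + r\<^sup>2 * ((sin t)\<^sup>2 + (cos t)\<^sup>2) - 2 * r * cos t"
    by algebra
  finally show ?thesis by simp
qed

text \<open>Half of the polylogarithmic and logarithmic terms of the first identity, in real form.
  The constant \<open>polylog 3 r\<close> makes it vanish at \<open>t = 0\<close>; there the factor
  \<open>t\<^sup>2\<close> also removes the logarithm, whose argument is 0 if
  \<open>r = 1\<close>.\<close>

definition arc_primitive :: "real \<Rightarrow> real \<Rightarrow> real" where
  "arc_primitive r t = Re (polylog 3 (rcis r t)) - Re (polylog 3 (of_real r))
     + t * Im (polylog 2 (rcis r t)) + t\<^sup>2 / 4 * ln (1 + r\<^sup>2 - 2 * r * cos t)"

lemma arc_primitive_0 [simp]: "arc_primitive r 0 = 0"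
  by (simp add: arc_primitive_def rcis_def)

lemma denominator_pos:
  fixes r t :: real
  assumes "0 \<le> r" "r < 1"
  shows "0 < 1 + r\<^sup>2 - 2 * r * cos t"
proof -
  have "rcis r t \<noteq> 1" using assms by (metis abs_of_nonneg complex_mod_rcis norm_one order_less_irrefl)
  then show ?thesis by (simp flip: norm_one_minus_rcis_sq)
qed

text \<open>The derivative of \<open>Re Li_3\<close> is \<open>- Im Li_2\<close> and that of
  \<open>Im Li_2\<close> is \<open>Re Li_1 = - ln ?D / 2\<close>. Hence the \<open>Li_2\<close>
  terms cancel, the logarithms cancel thanks to the coefficient \<open>1 / 4\<close>, and only the
  derivative of \<open>ln ?D\<close> inside the last summand survives.\<close>

lemma arc_primitive_has_real_derivative:
  assumes r: "0 \<le> r" "r < 1"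
  shows "(arc_primitive r has_real_derivative
           t\<^sup>2 / 2 * (r * sin t / (1 + r\<^sup>2 - 2 * r * cos t))) (at t)"
proof -
  let ?D = "1 + r\<^sup>2 - 2 * r * cos t"
  have D: "0 < ?D" by (rule denominator_pos[OF r])
  have "2 * ln (norm (1 - rcis r t)) = ln ?D"
    using D ln_realpow[of "norm (1 - rcis r t)" 2]
    by (auto simp flip: norm_one_minus_rcis_sq)
  moreover have "1 - rcis r t \<noteq> 0"
    using D by (auto simp flip: norm_one_minus_rcis_sq)
  ultimately have Re1: "Re (polylog 1 (rcis r t)) = - ln ?D / 2"
    using polylog_1[of "rcis r t"] r by simp
  have d3: "((\<lambda>t. Re (polylog 3 (rcis r t))) has_real_derivative - Im (polylog 2 (rcis r t))) (at t)"
    using bounded_linear.has_vector_derivative[OF bounded_linear_Re polylog_rcis_has_vector_derivative[OF r, of 2 t]]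
    by (simp add: has_real_derivative_iff_has_vector_derivative eval_nat_numeral)
  have d2: "((\<lambda>t. Im (polylog 2 (rcis r t))) has_real_derivative - ln ?D / 2) (at t)"
    using bounded_linear.has_vector_derivative[OF bounded_linear_Im polylog_rcis_has_vector_derivative[OF r, of 1 t]] Re1
    by (simp add: has_real_derivative_iff_has_vector_derivative eval_nat_numeral)
  show ?thesis
    unfolding arc_primitive_def[abs_def]
    by (rule derivative_eq_intros d3 d2 refl D | simp)+
       (use D in \<open>simp add: field_simps power2_eq_square\<close>)
qed

text \<open>The chain rule and the fundamental theorem of calculus. The derivative is required only
  in the open interval, since \<open>arcsin x\<close> is not differentiable at
  \<open>x = 1\<close>.\<close>

lemma arc_primitive_has_integral:
  assumes r: "0 \<le> r" "r < 1"
    and cont: "continuous_on {0..1} f" and f0: "f 0 = 0"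
    and der: "\<And>x. 0 < x \<Longrightarrow> x < 1 \<Longrightarrow> (f has_real_derivative f' x) (at x)"
  shows "((\<lambda>x. (f x)\<^sup>2 / 2 * (r * sin (f x) / (1 + r\<^sup>2 - 2 * r * cos (f x))) * f' x)
           has_integral arc_primitive r (f 1)) {0<..<1}"
proof -
  have "continuous_on UNIV (arc_primitive r)"
    by (rule DERIV_continuous_on) (rule arc_primitive_has_real_derivative[OF r])
  then have "continuous_on {0..1} (\<lambda>x. arc_primitive r (f x))"
    using cont by (rule continuous_on_compose2) auto
  then have "((\<lambda>x. (f x)\<^sup>2 / 2 * (r * sin (f x) / (1 + r\<^sup>2 - 2 * r * cos (f x))) * f' x)
           has_integral arc_primitive r (f 1) - arc_primitive r (f 0)) {0..1}"
  proof (rule fundamental_theorem_of_calculus_interior[rotated])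
    fix x :: real
    assume "x \<in> {0<..<1}"
    then have "(f has_real_derivative f' x) (at x)" by (intro der) auto
    from DERIV_chain2[OF arc_primitive_has_real_derivative[OF r] this]
    show "((\<lambda>x. arc_primitive r (f x)) has_vector_derivative
        (f x)\<^sup>2 / 2 * (r * sin (f x) / (1 + r\<^sup>2 - 2 * r * cos (f x))) * f' x) (at x)"
      by (simp only: has_real_derivative_iff_has_vector_derivative)
  qed simp
  then show ?thesis
    by (simp add: f0 has_integral_Icc_iff_Ioo)
qed

section \<open>The cotangent integral as a limit\<close>

text \<open>Replacing \<open>cot u\<close> by \<open>2 r sin 2u / (1 + r\<^sup>2 - 2 r cos 2u)\<close> avoids the conditionally convergent
  Fourier series on the unit circle; these kernels increase to \<open>cot u\<close> as \<open>r\<close> increases to \<open>1\<close>.\<close>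

lemma regularised_cot:
  fixes r u :: real
  assumes "0 \<le> r" "0 < sin u"
  shows "2 * (r * sin (2 * u) / (1 + r\<^sup>2 - 2 * r * cos (2 * u)))
           = cot u * (4 * r * (sin u)\<^sup>2 / ((1 - r)\<^sup>2 + 4 * r * (sin u)\<^sup>2))"
proof -
  have "1 + r\<^sup>2 - 2 * r * cos (2 * u) = (1 - r)\<^sup>2 + 4 * r * (sin u)\<^sup>2"
    unfolding cos_double_sin by algebra
  moreover have "2 * (r * (2 * sin u * cos u)) = cot u * (4 * r * (sin u)\<^sup>2)"
    using assms by (simp add: cot_def power2_eq_square)
  ultimately show ?thesis by (simp only: sin_double times_divide_eq_right)
qed

text \<open>The polylogarithms are continuous up to the unit circle, and
  \<open>cos t \<noteq> 1\<close> keeps the limit \<open>2 - 2 * cos t\<close> of the logarithm's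
  argument away from 0.\<close>

lemma tendsto_arc_primitive:
  assumes rl: "r \<longlonglongrightarrow> 1" and r: "\<And>k::nat. 0 \<le> r k" "\<And>k. r k < 1" and t: "cos t \<noteq> 1"
  shows "(\<lambda>k. arc_primitive (r k) t) \<longlonglongrightarrow> arc_primitive 1 t"
proof -
  have P: "(\<lambda>k. polylog j (rcis (r k) s)) \<longlonglongrightarrow> polylog j (rcis 1 s)" if "j \<ge> 2" for j s
  proof (rule continuous_on_tendsto_compose[OF continuous_on_polylog[OF that]])
    show "(\<lambda>k. rcis (r k) s) \<longlonglongrightarrow> rcis 1 s"
      unfolding rcis_def by (intro tendsto_intros rl)
    show "\<forall>\<^sub>F k in sequentially. rcis (r k) s \<in> cball 0 1"
      using r by (intro always_eventually) (auto simp: less_imp_le)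
  qed auto
  have P0: "(\<lambda>k. polylog 3 (of_real (r k))) \<longlonglongrightarrow> polylog 3 (of_real 1)"
    using P[of 3 0] by (simp add: rcis_def)
  show ?thesis
    unfolding arc_primitive_def
    by (intro tendsto_intros P P0 rl) (use t in auto)
qed

text \<open>Monotone convergence along radii increasing to 1: the regularised integrals are known
  exactly, and their values converge to the claimed one. The sign and range conditions make the
  integrand nonnegative, hence the approximations increasing.\<close>

lemma cot_has_integral:
  fixes f f' :: "real \<Rightarrow> real"
  assumes cont: "continuous_on {0..1} f" and f0: "f 0 = 0"
    and der: "\<And>x. 0 < x \<Longrightarrow> x < 1 \<Longrightarrow> (f has_real_derivative f' x) (at x)"
    and pos: "\<And>x. 0 < x \<Longrightarrow> x < 1 \<Longrightarrow> 0 \<le> f' x"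
    and rng: "\<And>x. 0 < x \<Longrightarrow> x < 1 \<Longrightarrow> 0 < f x \<and> f x < pi / 2"
    and f1: "0 < f 1" "f 1 \<le> pi / 2"
  shows "((\<lambda>x. (f x)\<^sup>2 * cot (f x) * f' x) has_integral arc_primitive 1 (2 * f 1) / 2) {0<..<1}"
proof -
  define r :: "nat \<Rightarrow> real" where "r k = real (Suc k) / real (Suc (Suc k))" for k
  have r: "0 < r k" "r k < 1" for k by (simp_all add: r_def)
  have r_mono: "r k \<le> r (Suc k)" for k by (simp add: r_def field_simps)
  have rl: "r \<longlonglongrightarrow> 1"
    unfolding r_def by (rule LIMSEQ_Suc[OF LIMSEQ_n_over_Suc_n])
  define q where "q s x = 4 * s * (sin (f x))\<^sup>2 / ((1 - s)\<^sup>2 + 4 * s * (sin (f x))\<^sup>2)" for s x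
  let ?g = "\<lambda>x. (f x)\<^sup>2 * cot (f x) * f' x"
  have sinpos: "0 < sin (f x)" if "x \<in> {0<..<1}" for x
    using rng[of x] that by (intro sin_gt_zero) auto
  have int: "((\<lambda>x. ?g x * q (r k) x) has_integral arc_primitive (r k) (2 * f 1) / 2) {0<..<1}" for k
  proof -
    \<comment> \<open>The primitive is used along \<open>2 * f\<close>: the factor
      \<open>(2 * f x)\<^sup>2 / 2 * (2 * f' x)\<close>, halved, is
      \<open>2 * (f x)\<^sup>2 * f' x\<close>, and the remaining 2 is the one in
      \<open>regularised_cot\<close>.\<close>
    have "((\<lambda>x. (2 * f x)\<^sup>2 / 2 * (r k * sin (2 * f x) / (1 + (r k)\<^sup>2 - 2 * r k * cos (2 * f x)))
             * (2 * f' x)) has_integral arc_primitive (r k) (2 * f 1)) {0<..<1}"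
      by (rule arc_primitive_has_integral)
         (use r[of k] f0 in \<open>auto intro!: derivative_eq_intros der continuous_intros cont\<close>)
    from has_integral_divide[OF this, of 2] show ?thesis
    proof (rule has_integral_eq[rotated], goal_cases)
      case (1 x)
      define R where "R = r k * sin (2 * f x) / (1 + (r k)\<^sup>2 - 2 * r k * cos (2 * f x))"
      have "cot (f x) * q (r k) x = 2 * R"
        using regularised_cot[of "r k" "f x"] r[of k] sinpos[OF 1] by (simp add: q_def R_def)
      then have *: "?g x * q (r k) x = (f x)\<^sup>2 * (2 * R) * f' x"
        by (metis mult.assoc mult.commute)
      show ?case unfolding R_def[symmetric] * by (simp add: power_mult_distrib)
    qed
  qed
  have lim: "(\<lambda>k. arc_primitive (r k) (2 * f 1) / 2) \<longlonglongrightarrow> arc_primitive 1 (2 * f 1) / 2"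
  proof (intro tendsto_intros tendsto_arc_primitive rl)
    have "0 < sin (f 1)" using f1 pi_gt_zero by (intro sin_gt_zero) linarith+
    then show "cos (2 * f 1) \<noteq> 1" by (simp add: cos_double_sin)
  qed (use r in \<open>auto intro: less_imp_le\<close>)
  have "?g integrable_on {0<..<1} \<and>
      (\<lambda>k. integral {0<..<1} (\<lambda>x. ?g x * q (r k) x)) \<longlonglongrightarrow> integral {0<..<1} ?g"
  proof (rule monotone_convergence_increasing)
    show "(\<lambda>x. ?g x * q (r k) x) integrable_on {0<..<1}" for k
      using int by blast
    show "?g x * q (r k) x \<le> ?g x * q (r (Suc k)) x" if "x \<in> {0<..<1}" for k x
    proof (rule mult_left_mono)
      \<comment> \<open>In this form the monotonicity in \<open>s\<close> is visible:
        \<open>(1 - s)\<^sup>2 / s\<close> decreases on the interval from 0 to 1.\<close>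
      have *: "q s x = 1 / (1 + (1 - s)\<^sup>2 / (4 * s * (sin (f x))\<^sup>2))" if "0 < s" for s
      proof -
        have "4 * s * (sin (f x))\<^sup>2 > 0" using that sinpos[OF \<open>x \<in> {0<..<1}\<close>] by simp
        moreover have "y / (c + y) = 1 / (1 + c / y)" if "0 < y" "0 \<le> c" for c y :: real
        proof -
          have "1 + c / y = (c + y) / y" using that by (simp add: add_divide_distrib)
          then show ?thesis by simp
        qed
        ultimately show ?thesis unfolding q_def by simp
      qed
      have "(1 - r (Suc k))\<^sup>2 / (4 * r (Suc k) * (sin (f x))\<^sup>2) \<le> (1 - r k)\<^sup>2 / (4 * r k * (sin (f x))\<^sup>2)"
        using r[of k] r[of "Suc k"] r_mono[of k] sinpos[OF that]
        by (intro frac_le power_mono mult_mono) auto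
      moreover have "0 \<le> (1 - r (Suc k))\<^sup>2 / (4 * r (Suc k) * (sin (f x))\<^sup>2)"
        using r(1)[of "Suc k"] by simp
      ultimately show "q (r k) x \<le> q (r (Suc k)) x"
        using *[of "r k"] *[of "r (Suc k)"] r by (simp add: frac_le)
      have "0 \<le> cot (f x)"
        using rng[of x] that by (auto intro!: less_imp_le cot_gt_zero)
      then show "0 \<le> ?g x" using pos[of x] that by simp
    qed
    show "(\<lambda>k. ?g x * q (r k) x) \<longlonglongrightarrow> ?g x" if "x \<in> {0<..<1}" for x
    proof -
      have "(\<lambda>k. ?g x * q (r k) x) \<longlonglongrightarrow> ?g x * q 1 x"
        unfolding q_def by (intro tendsto_intros rl) (use sinpos[OF that] in auto)
      then show ?thesis using sinpos[OF that] by (simp add: q_def)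
    qed
    show "bounded (range (\<lambda>k. integral {0<..<1} (\<lambda>x. ?g x * q (r k) x)))"
      unfolding integral_unique[OF int] by (rule convergent_imp_bounded[OF lim])
  qed
  moreover have "(\<lambda>k. integral {0<..<1} (\<lambda>x. ?g x * q (r k) x)) \<longlonglongrightarrow> arc_primitive 1 (2 * f 1) / 2"
    unfolding integral_unique[OF int] by (rule lim)
  ultimately have "?g integrable_on {0<..<1}"
      and "integral {0<..<1} ?g = arc_primitive 1 (2 * f 1) / 2"
    by (blast intro: LIMSEQ_unique)+
  then show ?thesis by (simp only: has_integral_iff)
qed

section \<open>The angles \<open>arcsin (s * x)\<close> and the diagonal values of
  \<open>S\<close>\<close>

text \<open>The usual derivative \<open>s / sqrt (1 - (s * x)\<^sup>2)\<close> is rewritten with a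
  tangent, which cancels against cotangents and exposes the factor \<open>1 / x\<close> of the
  integrand of \<open>S\<close>.\<close>

lemma arcsin_mult_has_real_derivative:
  fixes x s :: real
  assumes "0 \<le> s" "s \<le> 1" "0 < x" "x < 1"
  shows "((\<lambda>x. arcsin (s * x)) has_real_derivative tan (arcsin (s * x)) / x) (at x)"
proof -
  have lt: "s * x < 1" using assms mult_right_mono[of s 1 x] by linarith
  have ge: "0 \<le> s * x" using assms by simp
  have "cos (arcsin (s * x)) = sqrt (1 - (s * x)\<^sup>2)"
    using lt ge by (intro cos_arcsin) linarith+
  moreover have "sin (arcsin (s * x)) = s * x"
    using lt ge by (intro sin_arcsin) linarith+
  ultimately have eq: "tan (arcsin (s * x)) / x = inverse (sqrt (1 - (s * x)\<^sup>2)) * s"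
    using assms by (simp add: tan_def divide_inverse)
  have "((\<lambda>x. arcsin (s * x)) has_real_derivative inverse (sqrt (1 - (s * x)\<^sup>2)) * s) (at x)"
    by (rule DERIV_chain2[OF DERIV_arcsin]) (use lt ge in \<open>auto intro!: derivative_eq_intros\<close>)
  then show ?thesis by (simp only: eq)
qed

lemma continuous_on_arcsin_mult:
  fixes s :: real
  assumes "0 \<le> s" "s \<le> 1"
  shows "continuous_on {0..1} (\<lambda>x. arcsin (s * x))"
proof (intro continuous_on_arcsin continuous_intros ballI conjI)
  fix x :: real
  assume "x \<in> {0..1}"
  then show "s * x \<le> 1" "- 1 \<le> s * x"
    using assms mult_nonneg_nonneg[of s x] by (auto simp: mult_le_one simp del: mult_nonneg_nonneg)
qed

lemma arcsin_mult_bounds: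
  fixes s x :: real
  assumes "0 \<le> s" "s \<le> 1" "0 < x" "x < 1"
  shows "0 \<le> arcsin (s * x)" "arcsin (s * x) < pi / 2" "sin (arcsin (s * x)) = s * x"
    "0 < cos (arcsin (s * x))"
proof -
  have lt: "s * x < 1" using assms mult_right_mono[of s 1 x] by linarith
  have ge: "0 \<le> s * x" using assms by simp
  show 1: "0 \<le> arcsin (s * x)" using arcsin_le_arcsin[of 0 "s * x"] lt ge by simp
  show 2: "arcsin (s * x) < pi / 2" using arcsin_less_arcsin[of "s * x" 1] lt ge by simp
  show "sin (arcsin (s * x)) = s * x" using lt ge by simp
  show "0 < cos (arcsin (s * x))" using 1 2 by (intro cos_gt_zero_pi) auto
qed

text \<open>With \<open>f = arcsin (s * x)\<close> one has \<open>f' = tan f / x\<close>, so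
  \<open>f\<^sup>2 * cot f * f'\<close> is \<open>f\<^sup>2 / x\<close> and the cotangent integral
  applies.\<close>

lemma arcsin_sq_has_integral:
  assumes "0 < s" "s \<le> 1"
  shows "((\<lambda>x. (arcsin (s * x))\<^sup>2 / x) has_integral arc_primitive 1 (2 * arcsin s) / 2) {0<..<1}"
proof -
  let ?f = "\<lambda>x. arcsin (s * x)"
  have s: "0 \<le> s" using assms by simp
  have pos: "0 < ?f x" if "0 < x" "x \<le> 1" for x
    using arcsin_less_arcsin[of 0 "s * x"] assms that by (simp add: mult_le_one)
  have "((\<lambda>x. (?f x)\<^sup>2 * cot (?f x) * (tan (?f x) / x))
      has_integral arc_primitive 1 (2 * ?f 1) / 2) {0<..<1}"
  proof (rule cot_has_integral)
    show "0 \<le> tan (?f x) / x" if "0 < x" "x < 1" for x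
      using arcsin_mult_bounds[OF s assms(2) that] that assms by (simp add: tan_def)
    show "?f 1 \<le> pi / 2" using arcsin_le_arcsin[of s 1] assms by simp
    show "0 < ?f 1" by (rule pos) simp_all
  qed (use assms pos arcsin_mult_bounds[OF s assms(2)] continuous_on_arcsin_mult[OF s assms(2)]
        arcsin_mult_has_real_derivative[OF s assms(2)] in auto)
  then show ?thesis
    unfolding mult_1_right
  proof (rule has_integral_eq[rotated], goal_cases)
    case (1 x)
    then have "0 < cos (?f x)" "0 < sin (?f x)"
      using arcsin_mult_bounds[OF s assms(2), of x] assms by auto
    then show ?case by (simp add: cot_def tan_def)
  qed
qed

lemma S_diagonal:
  assumes "0 < s" "s \<le> 1"
  shows "S s s = arc_primitive 1 (2 * arcsin s) / 2"
  using arcsin_sq_has_integral[OF assms]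
  by (simp add: S_def power2_eq_square integral_unique flip: has_integral_Icc_iff_Ioo)

section \<open>Polarisation\<close>

text \<open>The identity \<open>1 / (x \<theta>') = cot \<theta> - r sin \<theta> / (1 + r\<^sup>2 - 2 r cos \<theta>)\<close> for
  \<open>\<theta> = arcsin (w x) - arcsin (v x)\<close> and \<open>r = v / w\<close>, in terms of the angles \<open>a\<close> and \<open>b\<close> with
  \<open>sin a = v x\<close> and \<open>sin b = w x\<close>.\<close>

lemma angle_difference_identity:
  fixes a b r :: real
  assumes "sin a = r * sin b" "sin b \<noteq> 0" "cos a \<noteq> 0" "cos b \<noteq> 0" "sin (b - a) \<noteq> 0"
  shows "(cot (b - a) - r * sin (b - a) / (1 + r\<^sup>2 - 2 * r * cos (b - a))) * (tan b - tan a) = 1"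
proof -
  define t where "t = b - a"
  have a: "a = b - t" by (simp add: t_def)
  \<comment> \<open>The triangle of circumdiameter 1 with angles \<open>a\<close>,
    \<open>pi - b\<close> and \<open>t\<close> has sides \<open>sin a\<close>, \<open>sin b\<close>
    and \<open>sin t\<close>; this is its law of cosines, verified algebraically.\<close>
  have "(sin b)\<^sup>2 * (1 + r\<^sup>2 - 2 * r * cos t) = (sin b)\<^sup>2 + (sin a)\<^sup>2 - 2 * sin a * sin b * cos t"
    unfolding assms(1) by (simp add: power2_eq_square algebra_simps)
  also have "\<dots> = (sin t)\<^sup>2"
  proof -
    have "sin a = sin b * cos t - cos b * sin t" by (simp add: a sin_diff)
    moreover have "(sin b)\<^sup>2 + (cos b)\<^sup>2 = 1" "(sin t)\<^sup>2 + (cos t)\<^sup>2 = 1" by simp_all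
    ultimately show ?thesis by algebra
  qed
  finally have D: "1 + r\<^sup>2 - 2 * r * cos t = (sin t)\<^sup>2 / (sin b)\<^sup>2"
    using assms(2) by (simp add: field_simps)
  have tan: "tan b - tan a = sin t / (cos a * cos b)"
    using assms by (simp add: t_def sin_diff tan_def field_simps)
  have t0: "sin t \<noteq> 0" using assms(5) by (simp add: t_def)
  have "r * sin t / (1 + r\<^sup>2 - 2 * r * cos t) = sin a * sin b / sin t"
    unfolding D using assms(2) t0 by (simp add: assms(1) field_simps power2_eq_square)
  moreover have "cos t = cos a * cos b + sin a * sin b"
    by (simp add: t_def cos_diff)
  ultimately have "cot t - r * sin t / (1 + r\<^sup>2 - 2 * r * cos t) = cos a * cos b / sin t"
    using t0 by (simp add: cot_def field_simps)
  then have "(cot t - r * sin t / (1 + r\<^sup>2 - 2 * r * cos t)) * (tan b - tan a) = 1"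
    unfolding tan using t0 assms by simp
  then show ?thesis by (simp only: t_def)
qed

text \<open>The product of two arcsines is obtained from their squares and the square of their
  difference \<open>f\<close>. The angle identity splits \<open>f\<^sup>2 / x\<close> into a
  cotangent part, which integrates to \<open>S (sin t) (sin t)\<close>, and a kernel part, which
  integrates to \<open>2 * arc_primitive (v / w) t\<close>.\<close>

lemma S_polarisation:
  assumes v: "0 \<le> v" and vw: "v < w" and w: "w \<le> 1" and t: "t = arcsin w - arcsin v"
  shows "2 * S v w = S v v + S w w - S (sin t) (sin t) + 2 * arc_primitive (v / w) t"
    and "0 < t" "t \<le> pi / 2"
proof -
  define r where "r = v / w"
  have r: "0 \<le> r" "r < 1" using v vw by (simp_all add: r_def)
  have v1: "v \<le> 1" and w0: "0 \<le> w" and w0': "0 < w" using v vw w by auto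
  let ?A = "\<lambda>x. arcsin (v * x)" and ?B = "\<lambda>x. arcsin (w * x)"
  define f where "f x = ?B x - ?A x" for x
  define f' where "f' x = (tan (?B x) - tan (?A x)) / x" for x
  note bv = arcsin_mult_bounds[OF v v1] and bw = arcsin_mult_bounds[OF w0 w]
  have fpos: "0 < f x" if "0 < x" "x \<le> 1" for x
  proof -
    have "v * x < w * x" "w * x \<le> 1" "0 \<le> v * x"
      using v vw w w0 that by (simp_all add: mult_le_one)
    then show ?thesis using arcsin_less_arcsin[of "v * x" "w * x"] by (simp add: f_def)
  qed
  have f0: "f 0 = 0" and f1: "f 1 = t" by (simp_all add: f_def t)
  show t0: "0 < t" using fpos[of 1] f1 by simp
  have "0 \<le> arcsin v" "arcsin w \<le> pi / 2"
    using arcsin_le_arcsin[of 0 v] arcsin_le_arcsin[of w 1] v v1 w w0 by auto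
  then show tpi: "t \<le> pi / 2" by (simp add: t)
  have cont: "continuous_on {0..1} f"
    unfolding f_def
    by (intro continuous_intros continuous_on_arcsin_mult v v1 w0 w)
  have der: "(f has_real_derivative f' x) (at x)" if "0 < x" "x < 1" for x
    unfolding f_def[abs_def] f'_def diff_divide_distrib
    by (intro DERIV_diff arcsin_mult_has_real_derivative that v v1 w0 w)
  have frng: "0 < f x \<and> f x < pi / 2" if "0 < x" "x < 1" for x
    using fpos[of x] that bv[OF that] bw[OF that] by (auto simp: f_def)
  have f'pos: "0 \<le> f' x" if "0 < x" "x < 1" for x
  proof -
    have "?A x < ?B x" using fpos[of x] that by (simp add: f_def)
    then have "tan (?A x) < tan (?B x)"
      using bv[OF that] bw[OF that] by (intro tan_monotone) auto
    then show ?thesis using that by (simp add: f'_def)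
  qed
  have Gint: "((\<lambda>x. (f x)\<^sup>2 * cot (f x) * f' x) has_integral arc_primitive 1 (2 * t) / 2) {0<..<1}"
    using cot_has_integral[OF cont f0 der f'pos frng] f1 t0 tpi by simp
  have Fint: "((\<lambda>x. (f x)\<^sup>2 / 2 * (r * sin (f x) / (1 + r\<^sup>2 - 2 * r * cos (f x))) * f' x)
      has_integral arc_primitive r t) {0<..<1}"
    using arc_primitive_has_integral[OF r cont f0 der] f1 by simp
  have "((\<lambda>x. (f x)\<^sup>2 * cot (f x) * f' x
        - 2 * ((f x)\<^sup>2 / 2 * (r * sin (f x) / (1 + r\<^sup>2 - 2 * r * cos (f x))) * f' x))
      has_integral arc_primitive 1 (2 * t) / 2 - 2 * arc_primitive r t) {0<..<1}"
    by (intro has_integral_diff Gint has_integral_mult_right Fint)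
  then have diff: "((\<lambda>x. (f x)\<^sup>2 / x)
      has_integral arc_primitive 1 (2 * t) / 2 - 2 * arc_primitive r t) {0<..<1}"
  proof (rule has_integral_eq[rotated], goal_cases)
    case (1 x)
    then have x: "0 < x" "x < 1" by auto
    have "(cot (f x) - r * sin (f x) / (1 + r\<^sup>2 - 2 * r * cos (f x))) * (tan (?B x) - tan (?A x)) = 1"
      unfolding f_def
    proof (rule angle_difference_identity)
      show "sin (?A x) = r * sin (?B x)" "sin (?B x) \<noteq> 0" "cos (?A x) \<noteq> 0" "cos (?B x) \<noteq> 0"
        using bv[OF x] bw[OF x] w0' x by (auto simp: r_def)
      have "0 < sin (f x)" using frng[OF x] by (intro sin_gt_zero) auto
      then show "sin (?B x - ?A x) \<noteq> 0" by (simp add: f_def)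
    qed
    then have "(f x)\<^sup>2 / x * ((cot (f x) - r * sin (f x) / (1 + r\<^sup>2 - 2 * r * cos (f x)))
        * (tan (?B x) - tan (?A x))) = (f x)\<^sup>2 / x"
      by simp
    moreover have "(f x)\<^sup>2 * c * f' x - 2 * ((f x)\<^sup>2 / 2 * d * f' x)
        = (f x)\<^sup>2 / x * ((c - d) * (tan (?B x) - tan (?A x)))" for c d
    proof -
      have "(f x)\<^sup>2 * c * (y / x) - 2 * ((f x)\<^sup>2 / 2 * d * (y / x)) = (f x)\<^sup>2 / x * ((c - d) * y)" for y
        by (simp add: diff_divide_distrib[symmetric] left_diff_distrib right_diff_distrib mult_ac)
      then show ?thesis by (simp only: f'_def)
    qed
    ultimately show ?case by (simp only:)
  qed
  \<comment> \<open>The case \<open>s = 0\<close>, where the integrand vanishes, is included because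
    \<open>v = 0\<close> is allowed.\<close>
  have Sdiag: "((\<lambda>x. (arcsin (s * x))\<^sup>2 / x) has_integral S s s) {0<..<1}"
    if "0 \<le> s" "s \<le> 1" for s
  proof (cases "s = 0")
    case True
    then show ?thesis by (simp add: S_def)
  next
    case False
    with that have s: "0 < s" "s \<le> 1" by simp_all
    show ?thesis unfolding S_diagonal[OF s] by (rule arcsin_sq_has_integral[OF s])
  qed
  have "((\<lambda>x. ((?A x)\<^sup>2 / x + (?B x)\<^sup>2 / x - (f x)\<^sup>2 / x) / 2)
      has_integral (S v v + S w w - (arc_primitive 1 (2 * t) / 2 - 2 * arc_primitive r t)) / 2) {0<..<1}"
    by (intro has_integral_divide has_integral_diff has_integral_add diff Sdiag v v1 w0 w)
  \<comment> \<open>Pointwise this is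
    \<open>(A\<^sup>2 + B\<^sup>2 - (B - A)\<^sup>2) / 2 = A * B\<close>.\<close>
  also have "(\<lambda>x. ((?A x)\<^sup>2 / x + (?B x)\<^sup>2 / x - (f x)\<^sup>2 / x) / 2) = (\<lambda>x. ?A x * ?B x / x)"
    by (simp add: f_def fun_eq_iff power2_eq_square algebra_simps
        flip: add_divide_distrib diff_divide_distrib)
  finally have "S v w = (S v v + S w w - (arc_primitive 1 (2 * t) / 2 - 2 * arc_primitive r t)) / 2"
    by (simp add: S_def integral_unique flip: has_integral_Icc_iff_Ioo)
  \<comment> \<open>The range of \<open>t\<close> gives \<open>arcsin (sin t) = t\<close>.\<close>
  moreover have "S (sin t) (sin t) = arc_primitive 1 (2 * t) / 2"
    using S_diagonal[of "sin t"] t0 tpi sin_gt_zero[of t] by (simp add: arcsin_sin)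
  ultimately show "2 * S v w = S v v + S w w - S (sin t) (sin t) + 2 * arc_primitive (v / w) t"
    by (simp add: r_def)
qed

section \<open>Complex form and the two identities\<close>

text \<open>The points \<open>z\<close> and \<open>z'\<close> are conjugate and the series have real
  coefficients. So the \<open>Li_3\<close> values add up to twice a real part, and the
  \<open>Li_2\<close> values, multiplied by \<open>- \<i> * t\<close> and \<open>\<i> * t\<close>,
  to \<open>2 * t\<close> times an imaginary part.\<close>

lemma arc_primitive_polylog:
  fixes r t :: real
  assumes "0 \<le> r" "r \<le> 1"
  defines "z \<equiv> of_real r * exp (\<i> * of_real t)" and "z' \<equiv> of_real r * exp (- \<i> * of_real t)"
  shows "of_real (2 * arc_primitive r t) = polylog 3 z + polylog 3 z' - 2 * polylog 3 (of_real r)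
      - \<i> * of_real t * polylog 2 z + \<i> * of_real t * polylog 2 z'
      + of_real (t\<^sup>2 / 2 * ln (1 + r\<^sup>2 - 2 * r * cos t))"
proof -
  have z: "z = rcis r t" by (simp add: z_def rcis_def cis_conv_exp)
  have z': "z' = cnj z" by (simp add: z_def z'_def exp_cnj)
  have nz: "norm z \<le> 1" using assms(1,2) by (simp add: z)
  have "Im (polylog 3 (of_real r)) = 0"
    using polylog_cnj[of 3 "of_real r"] assms by (simp add: complex_eq_iff)
  then show ?thesis
    unfolding z' polylog_cnj[OF order_refl nz] polylog_cnj[of 3, OF _ nz, simplified]
    by (simp add: complex_eq_iff arc_primitive_def z)
qed

theorem theorem5p4:
  shows
    "(\<forall>v w \<theta> :: real. 0 \<le> v \<and> v < w \<and> w \<le> 1 \<and> \<theta> = arcsin w - arcsin v \<longrightarrow>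
        complex_of_real (2 * S v w) =
          complex_of_real (S v v + S w w - S (sin \<theta>) (sin \<theta>))
          - 2 * polylog 3 (complex_of_real (v / w))
          + polylog 3 (complex_of_real (v / w) * exp (\<i> * complex_of_real \<theta>))
          + polylog 3 (complex_of_real (v / w) * exp (- \<i> * complex_of_real \<theta>))
          - \<i> * complex_of_real \<theta> * polylog 2 (complex_of_real (v / w) * exp (\<i> * complex_of_real \<theta>))
          + \<i> * complex_of_real \<theta> * polylog 2 (complex_of_real (v / w) * exp (- \<i> * complex_of_real \<theta>))
          + complex_of_real (\<theta>\<^sup>2 / 2 * ln (1 + v\<^sup>2 / w\<^sup>2 - 2 * v / w * cos \<theta>))
        \<and> 0 \<le> sin \<theta> \<and> sin \<theta> \<le> 1) \<and>
     (\<forall>s :: real. 0 \<le> s \<and> s \<le> 1 \<longrightarrow>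
        complex_of_real (S s s) =
          (polylog 3 (exp (2 * \<i> * complex_of_real (arcsin s)))
             + polylog 3 (exp (- 2 * \<i> * complex_of_real (arcsin s)))) / 4
          - complex_of_real (zeta_nat 3) / 2
          + complex_of_real (arcsin s)
              * ((polylog 2 (exp (2 * \<i> * complex_of_real (arcsin s)))
                  - polylog 2 (exp (- 2 * \<i> * complex_of_real (arcsin s)))) / (2 * \<i>))
          + complex_of_real ((arcsin s)\<^sup>2 * ln (2 * s)))"
proof (intro conjI allI impI; (elim conjE)?)
  fix v w \<theta> :: real
  assume v: "0 \<le> v" and vw: "v < w" and w: "w \<le> 1" and \<theta>: "\<theta> = arcsin w - arcsin v"
  note pol = S_polarisation[OF v vw w \<theta>]
  show "0 \<le> sin \<theta>" "sin \<theta> \<le> 1"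
    using pol(2,3) by (auto intro!: sin_ge_zero)
  have "0 \<le> v / w" "v / w \<le> 1" using v vw by auto
  from arc_primitive_polylog[OF this, of \<theta>]
  show "complex_of_real (2 * S v w) =
          complex_of_real (S v v + S w w - S (sin \<theta>) (sin \<theta>))
          - 2 * polylog 3 (complex_of_real (v / w))
          + polylog 3 (complex_of_real (v / w) * exp (\<i> * complex_of_real \<theta>))
          + polylog 3 (complex_of_real (v / w) * exp (- \<i> * complex_of_real \<theta>))
          - \<i> * complex_of_real \<theta> * polylog 2 (complex_of_real (v / w) * exp (\<i> * complex_of_real \<theta>))
          + \<i> * complex_of_real \<theta> * polylog 2 (complex_of_real (v / w) * exp (- \<i> * complex_of_real \<theta>))
          + complex_of_real (\<theta>\<^sup>2 / 2 * ln (1 + v\<^sup>2 / w\<^sup>2 - 2 * v / w * cos \<theta>))"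
    unfolding pol(1) of_real_add[of "S v v + S w w - S (sin \<theta>) (sin \<theta>)"]
    by (simp add: power_divide)
next
  fix s :: real
  assume s: "0 \<le> s" "s \<le> 1"
  define a where "a = arcsin s"
  define z where "z = exp (2 * \<i> * complex_of_real a)"
  define z' where "z' = exp (- 2 * \<i> * complex_of_real a)"
  have S: "S s s = arc_primitive 1 (2 * a) / 2"
    using S_diagonal[of s] s by (cases "s = 0") (auto simp: a_def S_def)
  have "1 + 1\<^sup>2 - 2 * 1 * cos (2 * a) = (2 * s)\<^sup>2"
    using s by (simp add: cos_double_sin a_def power_mult_distrib)
  \<comment> \<open>At \<open>s = 0\<close> both sides are 0 because \<open>a = 0\<close>, in
    agreement with the limit value of the logarithmic term.\<close>
  then have ln: "(2 * a)\<^sup>2 / 2 * ln (1 + 1\<^sup>2 - 2 * 1 * cos (2 * a)) = 4 * (a\<^sup>2 * ln (2 * s))"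
    using s ln_realpow[of "2 * s" 2] by (cases "s = 0") (simp_all add: a_def power_mult_distrib)
  have e: "exp (\<i> * complex_of_real (2 * a)) = z" "exp (- \<i> * complex_of_real (2 * a)) = z'"
    by (simp_all add: z_def z'_def mult_ac)
  have "complex_of_real (2 * arc_primitive 1 (2 * a)) = polylog 3 z + polylog 3 z'
      - 2 * complex_of_real (zeta_nat 3) - \<i> * complex_of_real (2 * a) * polylog 2 z
      + \<i> * complex_of_real (2 * a) * polylog 2 z' + complex_of_real (4 * (a\<^sup>2 * ln (2 * s)))"
    using arc_primitive_polylog[of 1 "2 * a"] unfolding ln e by (simp only: polylog_one e) (simp add: polylog_one e)
  moreover have "complex_of_real (S s s) = complex_of_real (2 * arc_primitive 1 (2 * a)) / 4"
    by (simp add: S)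
  moreover have div_i: "x / (2 * \<i>) = - (\<i> * x / 2)" for x
    by (simp add: field_simps)
  ultimately have "complex_of_real (S s s) = (polylog 3 z + polylog 3 z') / 4
      - complex_of_real (zeta_nat 3) / 2 + complex_of_real a * ((polylog 2 z - polylog 2 z') / (2 * \<i>))
      + complex_of_real (a\<^sup>2 * ln (2 * s))"
    unfolding div_i by (simp only:) (simp add: field_simps)
  then show "complex_of_real (S s s) =
          (polylog 3 (exp (2 * \<i> * complex_of_real (arcsin s)))
             + polylog 3 (exp (- 2 * \<i> * complex_of_real (arcsin s)))) / 4
          - complex_of_real (zeta_nat 3) / 2
          + complex_of_real (arcsin s)
              * ((polylog 2 (exp (2 * \<i> * complex_of_real (arcsin s)))
                  - polylog 2 (exp (- 2 * \<i> * complex_of_real (arcsin s)))) / (2 * \<i>))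
          + complex_of_real ((arcsin s)\<^sup>2 * ln (2 * s))"
    by (simp only: z_def z'_def a_def)
qed

end
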